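(* Let $(X,d)$ be a Hadamard space, let $\alpha>0$, and let $f:X\to\,]-\infty,+\infty]$ be a proper, lower semicontinuous function which is $\alpha$-weakly convex, quasi-convex, and continuous at every point of its domain $D(f)$. Suppose $\operatorname{Argmin} f\neq\varnothing$. Let $\bar\lambda>0$ and let $(\lambda_n)_{n\ge 0}$ be real numbers with $\bar\lambda\le\lambda_n<\frac{1}{2\alpha}$ for all $n$. Let $x_0\in X$ and define $x_{n+1}=J_{\lambda_n}x_n$ for $n\ge 0$. Then $(x_n)$ is $\Delta$-convergent to a critical point of $f$. If moreover $f$ is pseudo-convex, then this critical point is a minimum point of $f$.
   Context: A Hadamard space is a complete CAT(0) space; it is uniquely geodesic. For $x,y\in X$ and $t\in[0,1]$, $(1-t)x\oplus ty$ denotes the unique point $z$ of the geodesic segment $[x,y]$ with $d(x,z)=t\,d(x,y)$ and $d(y,z)=(1-t)d(x,y)$. For $f:X\to\,]-\infty,+\infty]$: $D(f)=\{x\in X: f(x)<+\infty\}$; $f$ is proper if $D(f)\ne\varnothing$; $f$ is lower semicontinuous if $\liminf_n f(y_n)\ge f(x)$ whenever $y_n\to x$ in $X$; $f$ is continuous at $x\in D(f)$ if $f(y_n)\to f(x)$ for every sequence $y_n\to x$ in $X$. $\operatorname{Argmin} f$ is the set of (global) minimum points of $f$. $f$ is $\alpha$-weakly convex if $f(\lambda x\oplus(1-\lambda)y)\le\lambda f(x)+(1-\lambda)f(y)+\alpha\lambda(1-\lambda)d^2(x,y)$ for all $x,y\in X$, $\lambda\in[0,1]$. $f$ is quasi-convex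 if $f(\lambda x\oplus(1-\lambda)y)\le\max\{f(x),f(y)\}$ for all $x,y\in X$, $\lambda\in[0,1]$. $f$ is pseudo-convex if, whenever $f(y)>f(x)$, there exist $\beta(x,y)>0$ and $0<\delta(x,y)\le1$ such that $f(y)-f(tx\oplus(1-t)y)\ge t\beta(x,y)$ for all $t\in(0,\delta(x,y))$. Slope and critical points: for $x\in D(f)$, $|\partial f|(x)=\limsup_{y\to x}\frac{\max\{f(x)-f(y),0\}}{d(x,y)}$; a point $x\in D(f)$ with $|\partial f|(x)=0$ is called a critical point of $f$. Resolvent: for $0<\lambda<\frac1{2\alpha}$ and $x\in X$, $J_\lambda x$ denotes the unique minimum point of $y\mapsto f(y)+\frac{1}{2\lambda}d^2(x,y)$ on $X$. $\Delta$-convergence: for a bounded sequence $(x_n)$ in $X$ put $r(x,\{x_n\})=\limsup_n d(x,x_n)$; the asymptotic center is $A(\{x_n\})=\{x\in X: r(x,\{x_n\})=\inf_{y\in X}r(y,\{x_n\})\}$ (a single point in a Hadamard space). $(x_n)$ $\Delta$-converges to $x$ if $A(\{x_{n_k}\})=\{x\}$ for every subsequence $(x_{n_k})$. *)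

theory Defs
  imports "HOL-Analysis.Analysis"
begin

definition geodesic_segment :: "'a::metric_space set \<Rightarrow> 'a \<Rightarrow> 'a \<Rightarrow> bool" where
  "geodesic_segment G x y \<longleftrightarrow>
     (\<exists>c. c 0 = x \<and> c (dist x y) = y \<and>
          (\<forall>s\<in>{0..dist x y}. \<forall>t\<in>{0..dist x y}. dist (c s) (c t) = \<bar>s - t\<bar>) \<and>
          G = c ` {0..dist x y})"

text \<open>
  In the comparison axiom, \<open>x'\<close>, \<open>y'\<close>, \<open>z'\<close> span a Euclidean comparison triangle and \<open>p'\<close>, \<open>q'\<close>
  are the comparison points of \<open>p\<close>, \<open>q\<close>. It suffices to treat points on the two sides issuing
  from \<open>x\<close>: any two distinct sides share a vertex, the vertices are arbitrary, and for two points
  on the same side equality is automatic. The third side exists by the first axiom.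
\<close>

class cat0_space = metric_space +
  assumes geodesic_segment_exists: "\<exists>G. geodesic_segment G x y"
  and cat0_comparison:
    "\<lbrakk>geodesic_segment G x y; geodesic_segment H x z; p \<in> G; q \<in> H;
      dist x' y' = dist x y; dist x' z' = dist x z; dist y' z' = dist y z;
      p' \<in> closed_segment x' y'; dist x' p' = dist x p;
      q' \<in> closed_segment x' z'; dist x' q' = dist x q\<rbrakk>
     \<Longrightarrow> dist p q \<le> dist (p' :: real ^ 2) q'"

class hadamard_space = cat0_space + complete_space

text \<open>
  \<open>geodesic_point x y t\<close> is $(1-t)x \oplus ty$; consequently $\lambda x \oplus (1-\lambda)y$ is
  \<open>geodesic_point x y (1 - \<lambda>)\<close>.
\<close>

definition geodesic_point :: "'a::metric_space \<Rightarrow> 'a \<Rightarrow> real \<Rightarrow> 'a" where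
  "geodesic_point x y t =
     (THE z. (\<exists>G. geodesic_segment G x y \<and> z \<in> G) \<and>
             dist x z = t * dist x y \<and> dist y z = (1 - t) * dist x y)"

definition effective_domain :: "('a \<Rightarrow> ereal) \<Rightarrow> 'a set" where
  "effective_domain f = {x. f x < \<infinity>}"

definition proper_function :: "('a \<Rightarrow> ereal) \<Rightarrow> bool" where
  "proper_function f \<longleftrightarrow> effective_domain f \<noteq> {}"

definition lower_semicontinuous :: "('a::metric_space \<Rightarrow> ereal) \<Rightarrow> bool" where
  "lower_semicontinuous f \<longleftrightarrow>
     (\<forall>x y. y \<longlonglongrightarrow> x \<longrightarrow> f x \<le> liminf (\<lambda>n. f (y n)))"

definition Argmin :: "('a \<Rightarrow> ereal) \<Rightarrow> 'a set" where
  "Argmin f = {x. \<forall>y. f x \<le> f y}"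

text \<open>
  On \<^typ>\<open>ereal\<close> we have $0 \cdot \infty = 0$, so for $\lambda \in \{0,1\}$ the inequality below
  holds trivially, also at points outside the effective domain.
\<close>

definition weakly_convex :: "real \<Rightarrow> ('a::metric_space \<Rightarrow> ereal) \<Rightarrow> bool" where
  "weakly_convex \<alpha> f \<longleftrightarrow>
     (\<forall>x y. \<forall>l\<in>{0..1}.
        f (geodesic_point x y (1 - l))
          \<le> ereal l * f x + ereal (1 - l) * f y + ereal (\<alpha> * l * (1 - l) * (dist x y)\<^sup>2))"

definition quasi_convex :: "('a::metric_space \<Rightarrow> ereal) \<Rightarrow> bool" where
  "quasi_convex f \<longleftrightarrow>
     (\<forall>x y. \<forall>l\<in>{0..1}. f (geodesic_point x y (1 - l)) \<le> max (f x) (f y))"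

text \<open>
  On \<^typ>\<open>ereal\<close> we have $\infty - \infty = \infty$, so the inequality below says
  $f(tx \oplus (1-t)y) + t\beta \le f(y)$, which is no restriction when $f(y) = \infty$.
\<close>

definition pseudo_convex :: "('a::metric_space \<Rightarrow> ereal) \<Rightarrow> bool" where
  "pseudo_convex f \<longleftrightarrow>
     (\<forall>x y. f y > f x \<longrightarrow>
        (\<exists>\<beta> \<delta> :: real. \<beta> > 0 \<and> 0 < \<delta> \<and> \<delta> \<le> 1 \<and>
           (\<forall>t\<in>{0<..<\<delta>}. f y - f (geodesic_point x y (1 - t)) \<ge> ereal (t * \<beta>))))"

text \<open>
  The outer maximum matters only at isolated points, where \<^const>\<open>Limsup\<close> over the trivial filter
  is $-\infty$ while the slope is $0$ by convention. In a geodesic space this happens only if the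
  space is a single point.
\<close>

definition slope :: "('a::metric_space \<Rightarrow> ereal) \<Rightarrow> 'a \<Rightarrow> ereal" where
  "slope f x = max 0 (Limsup (at x) (\<lambda>y. max (f x - f y) 0 / ereal (dist x y)))"

definition critical_point :: "('a::metric_space \<Rightarrow> ereal) \<Rightarrow> 'a \<Rightarrow> bool" where
  "critical_point f x \<longleftrightarrow> x \<in> effective_domain f \<and> slope f x = 0"

definition resolvent :: "('a::metric_space \<Rightarrow> ereal) \<Rightarrow> real \<Rightarrow> 'a \<Rightarrow> 'a" where
  "resolvent f l x = (THE y. y \<in> Argmin (\<lambda>y. f y + ereal (1 / (2 * l) * (dist x y)\<^sup>2)))"

definition asymptotic_radius :: "'a::metric_space \<Rightarrow> (nat \<Rightarrow> 'a) \<Rightarrow> ereal" where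
  "asymptotic_radius y x = limsup (\<lambda>n. ereal (dist y (x n)))"

definition asymptotic_center :: "(nat \<Rightarrow> 'a::metric_space) \<Rightarrow> 'a set" where
  "asymptotic_center x = {y. asymptotic_radius y x = (INF z. asymptotic_radius z x)}"

definition delta_converges :: "(nat \<Rightarrow> 'a::metric_space) \<Rightarrow> 'a \<Rightarrow> bool" where
  "delta_converges x p \<longleftrightarrow>
     bounded (range x) \<and> (\<forall>k. strict_mono k \<longrightarrow> asymptotic_center (x \<circ> k) = {p})"

end

theory Submission
  imports Defs
begin

text \<open>
  By quasi-convexity the proximal step satisfies
  $d(x_n, x_{n+1})^2 + d(x_{n+1}, y)^2 \le d(x_n, y)^2$ whenever $f(y) \le f(x_{n+1})$, so
  $(x_n)$ is Fejer monotone with respect to $S = \{f \le c\}$, where $c = \lim f(x_n)$.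
  Projecting onto the closed convex sublevel sets shows that the asymptotic center of every
  subsequence lies in $S$; hence $(x_n)$ is $\Delta$-convergent to some $p \in S$.

  The limit satisfies $f(y) \ge c - K d(p, y)^2$ for $y$ near $p$, which yields $f(p) = c$, slope
  $0$ at $p$, and minimality under pseudo-convexity. If the radius $R = \lim d(p, x_n)$
  is $0$, this is the limit of the inequality that defines the resolvent. If $R > 0$, let $z$ be the
  point of $[y, x_n]$ at distance $s$ from $y$, where $d(p, y) < s < R/2$. For large $n$ it
  is closer to $x_n$ than $R$, so $z \notin S$ by Fejer monotonicity. Thus
  $f > c$ at $z$ while $f \le f(x_n) \to c$ on $[y, x_n]$, and weak convexity keeps $f(y)$ above
  $c - 2 \alpha s^2$.
\<close>

section \<open>Geodesics and the CN inequality\<close>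

lemma geodesic_segment_point:
  assumes "geodesic_segment G x y" "0 \<le> t" "t \<le> 1"
  obtains z where "z \<in> G" "dist x z = t * dist x y" "dist y z = (1 - t) * dist x y"
proof -
  obtain c where c: "c 0 = x" "c (dist x y) = y" "G = c ` {0..dist x y}"
    "\<And>s u. s \<in> {0..dist x y} \<Longrightarrow> u \<in> {0..dist x y} \<Longrightarrow> dist (c s) (c u) = \<bar>s - u\<bar>"
    using assms(1) unfolding geodesic_segment_def by blast
  have t: "t * dist x y \<in> {0..dist x y}"
    using assms by (simp add: mult_left_le_one_le)
  show ?thesis
  proof
    show "c (t * dist x y) \<in> G" using c(3) t by blast
    show "dist x (c (t * dist x y)) = t * dist x y"
      using c(4)[of 0 "t * dist x y"] c(1) t by simp
    show "dist y (c (t * dist x y)) = (1 - t) * dist x y"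
      using c(4)[of "dist x y" "t * dist x y"] c(2) t by (simp add: algebra_simps)
  qed
qed

lemma geodesic_segment_end: "geodesic_segment G x y \<Longrightarrow> y \<in> G"
  unfolding geodesic_segment_def using atLeastAtMost_iff[of "dist x y" 0 "dist x y"]
  by (metis imageI order_refl zero_le_dist)

text \<open>Taking the vertex \<open>w\<close> itself as the second comparison point bounds
  \<open>dist w z\<close> by a distance in a planar triangle, where Stewart's theorem gives the
  right-hand side with equality.\<close>

lemma cat0_comparison_vertex:
  fixes x y w z :: "'a::cat0_space"
  assumes G: "geodesic_segment G x y" "z \<in> G" and t: "0 \<le> t" "t \<le> 1"
    and z: "dist x z = t * dist x y" and "x \<noteq> y"
  shows "(dist w z)\<^sup>2 \<le> (1 - t) * (dist w x)\<^sup>2 + t * (dist w y)\<^sup>2 - t * (1 - t) * (dist x y)\<^sup>2"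
proof -
  obtain H where H: "geodesic_segment H x w" using geodesic_segment_exists by blast
  define a where "a = dist x y"
  define b where "b = dist x w"
  define c where "c = dist y w"
  have a: "a > 0" using \<open>x \<noteq> y\<close> by (simp add: a_def)
  have tri: "a \<le> b + c" "b \<le> a + c" "c \<le> a + b" "b \<ge> 0" "c \<ge> 0"
    using dist_triangle[of x y w] dist_triangle[of x w y] dist_triangle[of y w x]
    by (simp_all add: a_def b_def c_def dist_commute)
  \<comment> \<open>With \<open>x'\<close> at the origin and \<open>y'\<close> on the first axis,
    the law of cosines forces \<open>u\<close> to be the first coordinate of
    \<open>w'\<close>.\<close>
  define u where "u = (a\<^sup>2 + b\<^sup>2 - c\<^sup>2) / (2 * a)"
  have u: "2 * a * u = a\<^sup>2 + b\<^sup>2 - c\<^sup>2" using a by (simp add: u_def)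
  \<comment> \<open>The triangle inequalities amount to \<open>\<bar>u\<bar> \<le> b\<close>, which
    makes the radicand of the second coordinate \<open>v\<close> nonnegative.\<close>
  have "c\<^sup>2 \<le> (a + b)\<^sup>2" using tri by (intro power_mono) auto
  moreover have "\<bar>a - b\<bar> \<le> \<bar>c\<bar>" using tri by linarith
  then have "(a - b)\<^sup>2 \<le> c\<^sup>2" by (simp add: abs_le_square_iff)
  ultimately have "- (2 * a * b) \<le> 2 * a * u" "2 * a * u \<le> 2 * a * b"
    unfolding u by (simp_all add: power2_eq_square algebra_simps)
  then have "2 * a * (- u) \<le> 2 * a * b" "2 * a * u \<le> 2 * a * b" by simp_all
  then have "\<bar>u\<bar> \<le> b" using a mult_le_cancel_left_pos[of "2 * a"] by (simp only: abs_le_iff)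
  then have ub: "u\<^sup>2 \<le> b\<^sup>2" using abs_le_square_iff[of u b] tri by simp
  define v where "v = sqrt (b\<^sup>2 - u\<^sup>2)"
  have v: "v\<^sup>2 = b\<^sup>2 - u\<^sup>2" using ub by (simp add: v_def)
  define x' y' w' p' :: "real^2" where "x' = 0" and "y' = vector [a, 0]" and "w' = vector [u, v]"
    and "p' = vector [t * a, 0]"
  have d: "dist (vector [r, s] :: real^2) (vector [r', s']) = sqrt ((r - r')\<^sup>2 + (s - s')\<^sup>2)" for r s r' s'
    by (simp add: dist_vec_def L2_set_def sum_2 dist_real_def)
  have x': "x' = vector [0, 0]" by (simp add: x'_def vec_eq_iff forall_2)
  have "p' = (1 - t) *\<^sub>R x' + t *\<^sub>R y'"
    by (simp add: x'_def y'_def p'_def vec_eq_iff forall_2)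
  then have seg: "p' \<in> closed_segment x' y'" using t unfolding closed_segment_def by blast
  have "dist z w \<le> dist p' w'"
  proof (rule cat0_comparison[OF G(1) H G(2) geodesic_segment_end[OF H], of x' y' w'])
    show "dist x' y' = dist x y" using a unfolding x' y'_def d by (simp add: a_def)
    show "dist x' w' = dist x w" using tri(4) unfolding x' w'_def d by (simp add: v b_def)
    then show "dist x' w' = dist x w" .
    have "(a - u)\<^sup>2 + v\<^sup>2 = c\<^sup>2" using u v by (simp add: power2_diff)
    then show "dist y' w' = dist y w" using tri(5) unfolding y'_def w'_def d by (simp add: c_def)
    show "p' \<in> closed_segment x' y'" by (rule seg)
    show "dist x' p' = dist x z" using a t z unfolding x' p'_def d by (simp add: a_def)
    show "w' \<in> closed_segment x' w'" by simp
  qed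
  then have "(dist z w)\<^sup>2 \<le> (dist p' w')\<^sup>2" by (simp add: power_mono)
  also have "\<dots> = (t * a - u)\<^sup>2 + v\<^sup>2" unfolding p'_def w'_def d by simp
  also have "\<dots> = t\<^sup>2 * a\<^sup>2 - t * (2 * a * u) + b\<^sup>2"
    using v by (simp add: power2_diff power_mult_distrib)
  also have "\<dots> = (1 - t) * b\<^sup>2 + t * c\<^sup>2 - t * (1 - t) * a\<^sup>2"
    unfolding u by (simp add: power2_eq_square algebra_simps)
  finally show ?thesis unfolding a_def b_def c_def by (simp only: dist_commute)
qed

text \<open>The definite description is meaningful because candidates are unique: for two candidates
  \<open>z1\<close> and \<open>z2\<close>, the inequality of \<open>cat0_comparison_vertex\<close>
  with \<open>w = z2\<close> has right-hand side 0.\<close>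

lemma geodesic_point:
  fixes x y w :: "'a::cat0_space"
  assumes t: "0 \<le> t" "t \<le> 1"
  shows dist_geodesic_point_left: "dist x (geodesic_point x y t) = t * dist x y"
    and dist_geodesic_point_right: "dist y (geodesic_point x y t) = (1 - t) * dist x y"
    and CN_inequality: "(dist w (geodesic_point x y t))\<^sup>2
      \<le> (1 - t) * (dist w x)\<^sup>2 + t * (dist w y)\<^sup>2 - t * (1 - t) * (dist x y)\<^sup>2"
proof -
  let ?P = "\<lambda>z. (\<exists>G. geodesic_segment G x y \<and> z \<in> G) \<and>
             dist x z = t * dist x y \<and> dist y z = (1 - t) * dist x y"
  obtain G where "geodesic_segment G x y" using geodesic_segment_exists by blast
  then obtain z where "?P z" using geodesic_segment_point[OF _ t] by metis
  moreover have "z1 = z2" if "?P z1" "?P z2" for z1 z2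
  proof (cases "x = y")
    case False
    then have "(dist z2 z1)\<^sup>2
        \<le> (1 - t) * (dist z2 x)\<^sup>2 + t * (dist z2 y)\<^sup>2 - t * (1 - t) * (dist x y)\<^sup>2"
      using cat0_comparison_vertex[OF _ _ t, of _ x y z1 z2] that by blast
    also have "\<dots> = 0"
    proof -
      have "dist z2 x = t * dist x y" "dist z2 y = (1 - t) * dist x y"
        using that(2) by (simp_all add: dist_commute)
      then show ?thesis by (simp only:) (simp add: power2_eq_square algebra_simps)
    qed
    finally show ?thesis by simp
  qed (use that in auto)
  ultimately have P: "?P (geodesic_point x y t)"
    unfolding geodesic_point_def by (intro theI[of ?P z]) auto
  then show "dist x (geodesic_point x y t) = t * dist x y"
    and "dist y (geodesic_point x y t) = (1 - t) * dist x y" by auto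
  show "(dist w (geodesic_point x y t))\<^sup>2
      \<le> (1 - t) * (dist w x)\<^sup>2 + t * (dist w y)\<^sup>2 - t * (1 - t) * (dist x y)\<^sup>2"
  proof (cases "x = y")
    case True
    then have "geodesic_point x y t = x" using P by auto
    with True show ?thesis by (simp add: algebra_simps)
  next
    case False
    then show ?thesis using cat0_comparison_vertex[OF _ _ t] P by metis
  qed
qed

lemma CN_inequality_midpoint:
  fixes x y w :: "'a::cat0_space"
  shows "(dist w (geodesic_point x y (1/2)))\<^sup>2
    \<le> ((dist w x)\<^sup>2 + (dist w y)\<^sup>2) / 2 - (dist x y)\<^sup>2 / 4"
  using CN_inequality[of "1/2" w x y] by (simp add: field_simps)

text \<open>Combine \<open>near\<close> with the CN inequality, divide by \<open>t\<close> and let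
  \<open>t\<close> tend to 0. This serves both metric projections and proximal steps.\<close>

lemma pythagoras_of_nearest_on_geodesic:
  fixes p q y :: "'a::cat0_space"
  assumes near: "\<And>t. 0 < t \<Longrightarrow> t < 1 \<Longrightarrow> dist p q \<le> dist p (geodesic_point q y t)"
  shows "(dist p q)\<^sup>2 + (dist q y)\<^sup>2 \<le> (dist p y)\<^sup>2"
proof -
  have "(dist p q)\<^sup>2 + (1 - t) * (dist q y)\<^sup>2 \<le> (dist p y)\<^sup>2" if t: "0 < t" "t < 1" for t
  proof -
    have "(dist p q)\<^sup>2 \<le> (dist p (geodesic_point q y t))\<^sup>2"
      using near[OF t] by (simp add: power_mono)
    also have "\<dots> \<le> (1 - t) * (dist p q)\<^sup>2 + t * (dist p y)\<^sup>2 - t * (1 - t) * (dist q y)\<^sup>2"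
      using t by (intro CN_inequality) auto
    finally have "t * ((dist p q)\<^sup>2 + (1 - t) * (dist q y)\<^sup>2) \<le> t * (dist p y)\<^sup>2"
      by (simp add: algebra_simps)
    with t show ?thesis by simp
  qed
  then have "\<forall>\<^sub>F t in at_right 0. (dist p q)\<^sup>2 + (1 - t) * (dist q y)\<^sup>2 \<le> (dist p y)\<^sup>2"
    by (auto intro!: eventually_at_rightI[of 0 1])
  moreover have "((\<lambda>t. (dist p q)\<^sup>2 + (1 - t) * (dist q y)\<^sup>2)
      \<longlongrightarrow> (dist p q)\<^sup>2 + (1 - 0) * (dist q y)\<^sup>2) (at_right 0)"
    by (intro tendsto_intros)
  ultimately show ?thesis using tendsto_upperbound[OF _ _ trivial_limit_at_right_real] by simp
qed

section \<open>Minimization of strongly convex functions\<close>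

lemma lower_semicontinuous_limit_le:
  assumes "lower_semicontinuous f" "y \<longlonglongrightarrow> p" "c \<longlonglongrightarrow> c'" "\<And>n. f (y n) \<le> ereal (c n)"
  shows "f p \<le> ereal c'"
proof -
  have "f p \<le> liminf (\<lambda>n. f (y n))"
    using assms(1,2) unfolding lower_semicontinuous_def by blast
  also have "\<dots> \<le> liminf (\<lambda>n. ereal (c n))"
    by (intro Liminf_mono always_eventually allI assms(4))
  also have "\<dots> = ereal c'"
    using assms(3) by (intro lim_imp_Liminf) auto
  finally show ?thesis .
qed

lemma closed_sublevel:
  assumes "lower_semicontinuous f"
  shows "closed {y. f y \<le> c}"
  unfolding closed_sequential_limits
proof (intro allI impI, elim conjE)
  fix y p assume y: "\<forall>n. y n \<in> {y. f y \<le> c}" "y \<longlonglongrightarrow> p"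
  have "f p \<le> liminf (\<lambda>n. f (y n))"
    using assms y(2) unfolding lower_semicontinuous_def by blast
  also have "\<dots> \<le> liminf (\<lambda>n. c)"
    using y(1) by (intro Liminf_mono always_eventually) auto
  finally show "p \<in> {y. f y \<le> c}" by (simp add: Liminf_const)
qed

text \<open>Minimizing sequences are Cauchy by strong convexity.\<close>

lemma strongly_convex_Argmin:
  fixes g :: "'a::complete_space \<Rightarrow> ereal"
  assumes lower: "\<And>y. ereal m \<le> g y" and proper: "g a < \<infinity>" and "\<kappa> > 0"
    and lsc: "\<And>y p c c'. y \<longlonglongrightarrow> p \<Longrightarrow> c \<longlonglongrightarrow> c' \<Longrightarrow> (\<And>n. g (y n) \<le> ereal (c n)) \<Longrightarrow> g p \<le> ereal c'"
    and mid: "\<And>y z a b. g y \<le> ereal a \<Longrightarrow> g z \<le> ereal b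
      \<Longrightarrow> g (M y z) \<le> ereal ((a + b) / 2 - \<kappa> * (dist y z)\<^sup>2)"
  shows "\<exists>p. Argmin g = {p}"
proof -
  define I where "I = (INF y. g y)"
  have "ereal m \<le> I" unfolding I_def by (intro INF_greatest lower)
  moreover have "I \<le> g a" unfolding I_def by (intro INF_lower) simp
  ultimately obtain i where i: "I = ereal i" using proper by (cases I) auto
  have i_le: "ereal i \<le> g y" for y unfolding i[symmetric] I_def by (intro INF_lower) simp
  \<comment> \<open>The infimum \<open>i\<close> also bounds \<open>g\<close> at
    \<open>M y z\<close> from below, which forces
    \<open>\<kappa> * (dist y z)\<^sup>2 \<le> (u + v) / 2\<close>. The case
    \<open>u = v = 0\<close> gives uniqueness below.\<close>
  have close: "(dist y z)\<^sup>2 \<le> (u + v) / (2 * \<kappa>)"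
    if "g y \<le> ereal (i + u)" "g z \<le> ereal (i + v)" for y z u v
  proof -
    have "ereal i \<le> ereal ((i + u + (i + v)) / 2 - \<kappa> * (dist y z)\<^sup>2)"
      by (rule order_trans[OF i_le mid[OF that]])
    then show ?thesis using \<open>\<kappa> > 0\<close> by (simp add: field_simps)
  qed
  have "\<exists>y. g y < ereal (i + inverse (real (Suc n)))" for n
  proof -
    have "I < ereal (i + inverse (real (Suc n)))" unfolding i by (simp add: field_simps)
    then show ?thesis unfolding I_def by (simp add: INF_less_iff)
  qed
  then obtain y where y: "\<And>n. g (y n) < ereal (i + inverse (real (Suc n)))" by metis
  have "Cauchy y"
  proof (rule metric_CauchyI)
    fix e :: real assume "e > 0"
    then have "\<kappa> * e\<^sup>2 > 0" using \<open>\<kappa> > 0\<close> by simp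
    then obtain N where N: "inverse (real (Suc N)) < \<kappa> * e\<^sup>2" using reals_Archimedean by blast
    have "dist (y j) (y k) < e" if "j \<ge> N" "k \<ge> N" for j k
    proof -
      have "inverse (real (Suc j)) \<le> inverse (real (Suc N))"
        "inverse (real (Suc k)) \<le> inverse (real (Suc N))" using that by (simp_all add: field_simps)
      then have s: "inverse (real (Suc j)) + inverse (real (Suc k)) < 2 * \<kappa> * e\<^sup>2" using N by linarith
      have "(dist (y j) (y k))\<^sup>2 \<le> (inverse (real (Suc j)) + inverse (real (Suc k))) / (2 * \<kappa>)"
        by (intro close less_imp_le y)
      also have "\<dots> < e\<^sup>2" using s \<open>\<kappa> > 0\<close> by (simp add: pos_divide_less_eq mult.commute mult.left_commute)
      finally show ?thesis using \<open>e > 0\<close> by (rule power2_less_imp_less[OF _ less_imp_le])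
    qed
    then show "\<exists>N. \<forall>j\<ge>N. \<forall>k\<ge>N. dist (y j) (y k) < e" by blast
  qed
  then obtain p where p: "y \<longlonglongrightarrow> p" by (metis Cauchy_convergent convergent_def)
  have "g p \<le> ereal i"
  proof (rule lsc[OF p])
    show "(\<lambda>n. i + inverse (real (Suc n))) \<longlonglongrightarrow> i"
      using tendsto_add[OF tendsto_const LIMSEQ_inverse_real_of_nat, of i] by simp
    show "g (y n) \<le> ereal (i + inverse (real (Suc n)))" for n by (rule less_imp_le[OF y])
  qed
  then have "p \<in> Argmin g" unfolding Argmin_def by (auto intro: order_trans i_le)
  moreover have "q = p" if "q \<in> Argmin g" for q
  proof -
    have "g q \<le> ereal i" using that \<open>g p \<le> ereal i\<close> unfolding Argmin_def by (auto intro: order_trans)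
    then have "(dist q p)\<^sup>2 \<le> 0" using close[of q 0 p 0] \<open>g p \<le> ereal i\<close> by simp
    then show ?thesis by simp
  qed
  ultimately show ?thesis by blast
qed

text \<open>The CN inequality makes the squared distance to \<open>p\<close> strongly convex; the
  value \<infinity> outside \<open>C\<close> turns the constrained problem into one on the whole
  space. Geodesics between points of \<open>C\<close> stay in \<open>C\<close>, so the minimizer is
  nearest to \<open>p\<close> on each of them.\<close>

lemma projection_exists:
  fixes C :: "'a::hadamard_space set"
  assumes "closed C" "C \<noteq> {}"
    and conv: "\<And>y z t. y \<in> C \<Longrightarrow> z \<in> C \<Longrightarrow> 0 \<le> t \<Longrightarrow> t \<le> 1 \<Longrightarrow> geodesic_point y z t \<in> C"
  obtains q where "q \<in> C" "\<And>y. y \<in> C \<Longrightarrow> (dist p q)\<^sup>2 + (dist q y)\<^sup>2 \<le> (dist p y)\<^sup>2"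
proof -
  define g where "g y = (if y \<in> C then ereal ((dist p y)\<^sup>2) else \<infinity>)" for y
  have g: "g y \<le> ereal c \<longleftrightarrow> y \<in> C \<and> (dist p y)\<^sup>2 \<le> c" for y c by (simp add: g_def)
  obtain a where "a \<in> C" using \<open>C \<noteq> {}\<close> by blast
  have "\<exists>q. Argmin g = {q}"
  proof (rule strongly_convex_Argmin)
    show "ereal 0 \<le> g y" for y by (simp add: g_def)
    show "g a < \<infinity>" using \<open>a \<in> C\<close> by (simp add: g_def)
    show "(1/4::real) > 0" by simp
    show "g q \<le> ereal c'" if "y \<longlonglongrightarrow> q" "c \<longlonglongrightarrow> c'" "\<And>n. g (y n) \<le> ereal (c n)" for y q c c'
    proof -
      have "q \<in> C" using closed_sequentially[OF \<open>closed C\<close> _ that(1)] that(3) unfolding g by blast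
      moreover have "(dist p q)\<^sup>2 \<le> c'"
        by (rule LIMSEQ_le[of "\<lambda>n. (dist p (y n))\<^sup>2" _ c]) (use that g in \<open>auto intro!: tendsto_intros\<close>)
      ultimately show ?thesis by (simp add: g)
    qed
    show "g (geodesic_point y z (1/2)) \<le> ereal ((b + c) / 2 - 1/4 * (dist y z)\<^sup>2)"
      if "g y \<le> ereal b" "g z \<le> ereal c" for y z b c
      using that conv[of y z "1/2"] CN_inequality_midpoint[of p y z] unfolding g by (simp add: field_simps)
  qed
  then obtain q where q: "\<And>y. g q \<le> g y" unfolding Argmin_def by blast
  have "q \<in> C" using q[of a] \<open>a \<in> C\<close> by (auto simp: g_def split: if_splits)
  have "dist p q \<le> dist p y" if "y \<in> C" for y
    using q[of y] that \<open>q \<in> C\<close> by (simp add: g_def flip: abs_le_square_iff)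
  then have "(dist p q)\<^sup>2 + (dist q y)\<^sup>2 \<le> (dist p y)\<^sup>2" if "y \<in> C" for y
    using conv[OF \<open>q \<in> C\<close> that] by (intro pythagoras_of_nearest_on_geodesic) (simp add: less_imp_le)
  with \<open>q \<in> C\<close> show ?thesis by (rule that)
qed

section \<open>Asymptotic centers\<close>

text \<open>A real-valued copy avoids extended arithmetic; for bounded sequences nothing is lost, by
  \<open>asymptotic_radius_eq\<close>.\<close>

definition real_asymptotic_radius :: "'a::metric_space \<Rightarrow> (nat \<Rightarrow> 'a) \<Rightarrow> real" where
  "real_asymptotic_radius y x = real_of_ereal (asymptotic_radius y x)"

lemma asymptotic_radius_le:
  "\<forall>\<^sub>F n in sequentially. dist y (x n) \<le> a \<Longrightarrow> asymptotic_radius y x \<le> ereal a"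
  unfolding asymptotic_radius_def by (rule Limsup_bounded) simp

lemma
  assumes "bounded (range x)"
  shows asymptotic_radius_eq: "asymptotic_radius y x = ereal (real_asymptotic_radius y x)"
    and real_asymptotic_radius_nonneg: "real_asymptotic_radius y x \<ge> 0"
proof -
  obtain B where "\<And>n. dist y (x n) \<le> B"
    using assms unfolding bounded_any_center[of _ y] by auto
  then have "asymptotic_radius y x \<le> ereal B"
    by (intro asymptotic_radius_le) simp
  moreover have "0 \<le> asymptotic_radius y x"
    unfolding asymptotic_radius_def by (rule le_Limsup) simp_all
  ultimately show "asymptotic_radius y x = ereal (real_asymptotic_radius y x)"
    and "real_asymptotic_radius y x \<ge> 0"
    unfolding real_asymptotic_radius_def by (cases "asymptotic_radius y x"; simp)+
qed

lemma real_asymptotic_radius_le: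
  assumes "bounded (range x)" "\<forall>\<^sub>F n in sequentially. dist y (x n) \<le> a"
  shows "real_asymptotic_radius y x \<le> a"
  using asymptotic_radius_le[OF assms(2)] asymptotic_radius_eq[OF assms(1)] by simp

lemma eventually_dist_less_of_radius_less:
  assumes "bounded (range x)" "real_asymptotic_radius y x < a"
  shows "\<forall>\<^sub>F n in sequentially. dist y (x n) < a"
proof -
  have "limsup (\<lambda>n. ereal (dist y (x n))) < ereal a"
    using asymptotic_radius_eq[OF assms(1), of y] assms(2) by (simp add: asymptotic_radius_def)
  from Limsup_lessD[OF this] show ?thesis by simp
qed

text \<open>The CN inequality yields estimates of squared distances; monotonicity of
  \<open>sqrt\<close> carries them over to the radius.\<close>

lemma real_asymptotic_radius_power2_le:
  assumes "bounded (range x)" "\<forall>\<^sub>F n in sequentially. (dist y (x n))\<^sup>2 \<le> a"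
  shows "(real_asymptotic_radius y x)\<^sup>2 \<le> a"
proof -
  have "\<forall>\<^sub>F n in sequentially. dist y (x n) \<le> sqrt a"
    using assms(2) by (rule eventually_mono) (rule real_le_rsqrt)
  then have le: "real_asymptotic_radius y x \<le> sqrt a"
    by (rule real_asymptotic_radius_le[OF assms(1)])
  \<comment> \<open>In HOL the root of a negative real is negative, so \<open>0 \<le> sqrt a\<close>
    already yields \<open>0 \<le> a\<close>.\<close>
  then have "a \<ge> 0"
    using real_asymptotic_radius_nonneg[OF assms(1), of y] by (metis order_trans real_sqrt_ge_0_iff)
  then show ?thesis
    using power_mono[OF le real_asymptotic_radius_nonneg[OF assms(1)], of 2] by simp
qed

lemma eventually_dist_power2_less_of_radius_power2_less:
  assumes "bounded (range x)" "(real_asymptotic_radius y x)\<^sup>2 < a"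
  shows "\<forall>\<^sub>F n in sequentially. (dist y (x n))\<^sup>2 < a"
proof -
  have "real_asymptotic_radius y x < sqrt a" using assms(2) by (rule real_less_rsqrt)
  then have "\<forall>\<^sub>F n in sequentially. dist y (x n) < sqrt a"
    by (rule eventually_dist_less_of_radius_less[OF assms(1)])
  then show ?thesis
  proof (rule eventually_mono)
    fix n assume "dist y (x n) < sqrt a"
    then have "sqrt ((dist y (x n))\<^sup>2) < sqrt a" by simp
    then show "(dist y (x n))\<^sup>2 < a" by (simp only: real_sqrt_less_iff)
  qed
qed

text \<open>This supplies the semicontinuity of the radius in its center, which the existence of a
  minimizer requires.\<close>

lemma real_asymptotic_radius_triangle:
  assumes "bounded (range x)"
  shows "real_asymptotic_radius y x \<le> dist y z + real_asymptotic_radius z x"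
proof (rule field_le_epsilon)
  fix e :: real assume "e > 0"
  have "\<forall>\<^sub>F n in sequentially. dist z (x n) < real_asymptotic_radius z x + e"
    using \<open>e > 0\<close> by (intro eventually_dist_less_of_radius_less assms) simp
  then have "\<forall>\<^sub>F n in sequentially. dist y (x n) \<le> dist y z + real_asymptotic_radius z x + e"
  proof (rule eventually_mono)
    fix n assume "dist z (x n) < real_asymptotic_radius z x + e"
    then show "dist y (x n) \<le> dist y z + real_asymptotic_radius z x + e"
      using dist_triangle[of y "x n" z] by linarith
  qed
  then show "real_asymptotic_radius y x \<le> dist y z + real_asymptotic_radius z x + e"
    by (rule real_asymptotic_radius_le[OF assms])
qed

lemma asymptotic_center_iff:
  assumes "bounded (range x)"
  shows "p \<in> asymptotic_center x \<longleftrightarrow> (\<forall>y. real_asymptotic_radius p x \<le> real_asymptotic_radius y x)"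
proof -
  have "p \<in> asymptotic_center x \<longleftrightarrow> (\<forall>y. asymptotic_radius p x \<le> asymptotic_radius y x)"
    unfolding asymptotic_center_def
    by (auto intro!: antisym INF_lower INF_greatest)
  then show ?thesis by (simp add: asymptotic_radius_eq[OF assms])
qed

text \<open>The CN inequality seen from each \<open>x n\<close> passes to the upper limit, so the
  squared radius is strongly convex, and the asymptotic center is its set of minimizers.\<close>

lemma asymptotic_center_singleton:
  fixes x :: "nat \<Rightarrow> 'a::hadamard_space"
  assumes "bounded (range x)"
  obtains p where "asymptotic_center x = {p}"
proof -
  define \<rho> where "\<rho> y = real_asymptotic_radius y x" for y
  have nonneg: "\<rho> y \<ge> 0" for y
    unfolding \<rho>_def by (rule real_asymptotic_radius_nonneg[OF assms])
  have "\<exists>p. Argmin (\<lambda>y. ereal ((\<rho> y)\<^sup>2)) = {p}"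
  proof (rule strongly_convex_Argmin)
    show "ereal 0 \<le> ereal ((\<rho> y)\<^sup>2)" for y by simp
    show "ereal ((\<rho> undefined)\<^sup>2) < \<infinity>" by simp
    show "(1/4::real) > 0" by simp
    show "ereal ((\<rho> p)\<^sup>2) \<le> ereal c'"
      if "y \<longlonglongrightarrow> p" "c \<longlonglongrightarrow> c'" and le: "\<And>n. ereal ((\<rho> (y n))\<^sup>2) \<le> ereal (c n)" for y p c c'
    proof -
      have "\<rho> p \<le> dist p (y n) + sqrt (c n)" for n
        using real_asymptotic_radius_triangle[OF assms, of p "y n"] real_le_rsqrt[of "\<rho> (y n)" "c n"] le[of n]
        unfolding \<rho>_def by simp
      moreover have "(\<lambda>n. dist p (y n) + sqrt (c n)) \<longlonglongrightarrow> dist p p + sqrt c'"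
        using that by (intro tendsto_intros)
      ultimately have \<rho>: "\<rho> p \<le> sqrt c'" using LIMSEQ_le_const by fastforce
      then have "c' \<ge> 0" using nonneg[of p] by (metis order_trans real_sqrt_ge_0_iff)
      then show ?thesis using power_mono[OF \<rho> nonneg, of 2] by simp
    qed
    show "ereal ((\<rho> (geodesic_point y z (1/2)))\<^sup>2) \<le> ereal ((a + b) / 2 - 1/4 * (dist y z)\<^sup>2)"
      if "ereal ((\<rho> y)\<^sup>2) \<le> ereal a" "ereal ((\<rho> z)\<^sup>2) \<le> ereal b" for y z a b
    proof -
      \<comment> \<open>A bound on the upper limit holds for the terms only eventually and up to a
        slack \<open>e\<close>, which is removed at the end.\<close>
      have "(\<rho> (geodesic_point y z (1/2)))\<^sup>2 \<le> (a + b) / 2 - 1/4 * (dist y z)\<^sup>2 + e" if "e > 0" for e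
      proof -
        have "\<forall>\<^sub>F n in sequentially. (dist y (x n))\<^sup>2 < a + e"
          and "\<forall>\<^sub>F n in sequentially. (dist z (x n))\<^sup>2 < b + e"
          using \<open>ereal ((\<rho> y)\<^sup>2) \<le> ereal a\<close> \<open>ereal ((\<rho> z)\<^sup>2) \<le> ereal b\<close> \<open>e > 0\<close>
          unfolding \<rho>_def by (auto intro!: eventually_dist_power2_less_of_radius_power2_less[OF assms])
        then have "\<forall>\<^sub>F n in sequentially. (dist (geodesic_point y z (1/2)) (x n))\<^sup>2
            \<le> (a + b) / 2 - 1/4 * (dist y z)\<^sup>2 + e"
        proof eventually_elim
          case (elim n)
          then show ?case
            using CN_inequality_midpoint[of "x n" y z] by (simp add: dist_commute field_simps)
        qed
        then show ?thesis
          unfolding \<rho>_def by (rule real_asymptotic_radius_power2_le[OF assms])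
      qed
      then show ?thesis by (simp add: field_le_epsilon)
    qed
  qed
  moreover have "Argmin (\<lambda>y. ereal ((\<rho> y)\<^sup>2)) = asymptotic_center x"
    using nonneg
    by (auto simp: Argmin_def asymptotic_center_iff[OF assms] \<rho>_def power2_le_iff_abs_le abs_of_nonneg)
  ultimately show ?thesis using that by auto
qed

text \<open>Projecting onto \<open>C\<close> decreases the distance to every point of \<open>C\<close>.\<close>

lemma asymptotic_center_in_closed_convex:
  fixes x :: "nat \<Rightarrow> 'a::hadamard_space"
  assumes "bounded (range x)" "closed C" "\<forall>\<^sub>F n in sequentially. x n \<in> C"
    and conv: "\<And>y z t. y \<in> C \<Longrightarrow> z \<in> C \<Longrightarrow> 0 \<le> t \<Longrightarrow> t \<le> 1 \<Longrightarrow> geodesic_point y z t \<in> C"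
    and "p \<in> asymptotic_center x"
  shows "p \<in> C"
proof -
  have "C \<noteq> {}" using assms(3) by (auto simp: eventually_sequentially)
  from projection_exists[OF \<open>closed C\<close> this conv]
  obtain q where "q \<in> C" and q: "\<And>y. y \<in> C \<Longrightarrow> (dist p q)\<^sup>2 + (dist q y)\<^sup>2 \<le> (dist p y)\<^sup>2" by blast
  \<comment> \<open>Moving from \<open>p\<close> to its projection \<open>q\<close> lowers the
    squared radius by at least \<open>(dist p q)\<^sup>2\<close>; since \<open>p\<close> minimizes
    the radius, the two points coincide.\<close>
  have "(real_asymptotic_radius q x)\<^sup>2 \<le> (real_asymptotic_radius p x)\<^sup>2 - (dist p q)\<^sup>2 + e" if "e > 0" for e
  proof (rule real_asymptotic_radius_power2_le[OF assms(1)])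
    have "\<forall>\<^sub>F n in sequentially. (dist p (x n))\<^sup>2 < (real_asymptotic_radius p x)\<^sup>2 + e"
      using \<open>e > 0\<close> by (intro eventually_dist_power2_less_of_radius_power2_less assms(1)) simp
    with assms(3) show "\<forall>\<^sub>F n in sequentially.
        (dist q (x n))\<^sup>2 \<le> (real_asymptotic_radius p x)\<^sup>2 - (dist p q)\<^sup>2 + e"
    proof eventually_elim
      case (elim n)
      then show ?case using q[of "x n"] by linarith
    qed
  qed
  then have "(real_asymptotic_radius q x)\<^sup>2 \<le> (real_asymptotic_radius p x)\<^sup>2 - (dist p q)\<^sup>2"
    by (rule field_le_epsilon)
  moreover have "(real_asymptotic_radius p x)\<^sup>2 \<le> (real_asymptotic_radius q x)\<^sup>2"
    using assms(5) real_asymptotic_radius_nonneg[OF assms(1)]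
    unfolding asymptotic_center_iff[OF assms(1)] by (simp add: power_mono)
  ultimately have "(dist p q)\<^sup>2 \<le> 0" by linarith
  then show ?thesis using \<open>q \<in> C\<close> by simp
qed

section \<open>Fejer monotone sequences and \<Delta>-convergence\<close>

lemma real_asymptotic_radius_eq_lim:
  assumes "(\<lambda>n. dist y (x n)) \<longlonglongrightarrow> L"
  shows "real_asymptotic_radius y x = L"
proof -
  have "limsup (\<lambda>n. ereal (dist y (x n))) = ereal L"
    using assms by (intro lim_imp_Limsup) auto
  then show ?thesis by (simp add: real_asymptotic_radius_def asymptotic_radius_def)
qed

text \<open>An analogue of Opial's lemma, with asymptotic centers of subsequences in place of weak cluster
  points: on \<open>S\<close> the asymptotic radius is the same for the sequence and all its subsequences.\<close>

lemma fejer_monotone_delta_converges: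
  fixes x :: "nat \<Rightarrow> 'a::hadamard_space"
  assumes bdd: "bounded (range x)"
    and fejer: "\<And>y n. y \<in> S \<Longrightarrow> dist y (x (Suc n)) \<le> dist y (x n)"
    and center: "\<And>k. strict_mono k \<Longrightarrow> asymptotic_center (x \<circ> k) \<subseteq> S"
  obtains p where "p \<in> S" "p \<in> asymptotic_center x" "delta_converges x p"
proof -
  have convergent: "\<exists>L. (\<lambda>n. dist y (x n)) \<longlonglongrightarrow> L" if "y \<in> S" for y
    using decseq_convergent[of "\<lambda>n. dist y (x n)" 0] fejer[OF that]
    by (metis decseq_SucI zero_le_dist)
  have radius: "real_asymptotic_radius y (x \<circ> k) = real_asymptotic_radius y x"
    if "y \<in> S" "strict_mono k" for y k
  proof -
    obtain L where L: "(\<lambda>n. dist y (x n)) \<longlonglongrightarrow> L"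
      using convergent[OF \<open>y \<in> S\<close>] by blast
    then have "(\<lambda>n. dist y ((x \<circ> k) n)) \<longlonglongrightarrow> L"
      using LIMSEQ_subseq_LIMSEQ[OF L \<open>strict_mono k\<close>] by (simp add: o_def)
    with L show ?thesis by (simp add: real_asymptotic_radius_eq_lim)
  qed
  obtain p where p: "asymptotic_center x = {p}" using asymptotic_center_singleton[OF bdd] .
  then have "p \<in> S" using center[of id] strict_mono_id by auto
  have "asymptotic_center (x \<circ> k) = {p}" if k: "strict_mono k" for k
  proof -
    have bddk: "bounded (range (x \<circ> k))" by (rule bounded_subset[OF bdd]) auto
    then obtain q where q: "asymptotic_center (x \<circ> k) = {q}" using asymptotic_center_singleton by blast
    then have "q \<in> S" using center[OF k] by auto
    \<comment> \<open>The point \<open>p\<close> beats \<open>q\<close> for the whole sequence, and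
      on \<open>S\<close> both radii are unchanged along \<open>k\<close>. Hence \<open>p\<close> is
      also a center of the subsequence, whose only center is \<open>q\<close>.\<close>
    have "real_asymptotic_radius p (x \<circ> k) \<le> real_asymptotic_radius q (x \<circ> k)"
      using p asymptotic_center_iff[OF bdd, of p] by (simp add: radius \<open>p \<in> S\<close> \<open>q \<in> S\<close> k)
    moreover have "real_asymptotic_radius q (x \<circ> k) \<le> real_asymptotic_radius y (x \<circ> k)" for y
      using q asymptotic_center_iff[OF bddk, of q] by simp
    ultimately have "p \<in> asymptotic_center (x \<circ> k)"
      unfolding asymptotic_center_iff[OF bddk] using order_trans by blast
    with q show ?thesis by simp
  qed
  with bdd have "delta_converges x p" unfolding delta_converges_def by blast
  with \<open>p \<in> S\<close> p show ?thesis using that by blast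
qed

section \<open>The proximal point algorithm\<close>

lemma quasi_convex_geodesic_le:
  assumes "quasi_convex f" "0 \<le> t" "t \<le> 1"
  shows "f (geodesic_point y z t) \<le> max (f y) (f z)"
  using assms(1)[unfolded quasi_convex_def, rule_format, of "1 - t" y z] assms(2,3) by simp

lemma weakly_convex_midpoint:
  assumes "weakly_convex \<alpha> f" "f y \<le> ereal a" "f z \<le> ereal b"
  shows "f (geodesic_point y z (1/2)) \<le> ereal ((a + b) / 2 + \<alpha> / 4 * (dist y z)\<^sup>2)"
proof -
  have "f (geodesic_point y z (1/2))
      \<le> ereal (1/2) * f y + ereal (1/2) * f z + ereal (\<alpha> / 4 * (dist y z)\<^sup>2)"
    using assms(1)[unfolded weakly_convex_def, rule_format, of "1/2" y z] by simp
  also have "\<dots> \<le> ereal (1/2) * ereal a + ereal (1/2) * ereal b + ereal (\<alpha> / 4 * (dist y z)\<^sup>2)"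
    using assms(2,3) by (intro add_mono ereal_mult_left_mono) auto
  finally show ?thesis by (simp add: field_simps)
qed

text \<open>At midpoints the quadratic term gains \<open>k / 4\<close> by the CN inequality and weak
  convexity loses \<open>\<alpha> / 4\<close>, both times the squared distance. The bound on
  \<open>l\<close> says exactly that \<open>k > \<alpha>\<close>, so the objective is strongly
  convex and the definite description names its minimizer.\<close>

lemma resolvent_minimizes:
  fixes f :: "'a::hadamard_space \<Rightarrow> ereal"
  assumes lower: "\<And>y. ereal m \<le> f y" and proper: "f a < \<infinity>"
    and lsc: "lower_semicontinuous f" and wc: "weakly_convex \<alpha> f"
    and l: "0 < l" "l < 1 / (2 * \<alpha>)" and "\<alpha> > 0"
  shows "f (resolvent f l x) + ereal (1 / (2 * l) * (dist x (resolvent f l x))\<^sup>2)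
    \<le> f y + ereal (1 / (2 * l) * (dist x y)\<^sup>2)"
proof -
  define k where "k = 1 / (2 * l)"
  have "k > 0" using l by (simp add: k_def)
  have "k > \<alpha>" using l \<open>\<alpha> > 0\<close> by (simp add: k_def field_simps)
  define F where "F y = f y + ereal (k * (dist x y)\<^sup>2)" for y
  \<comment> \<open>Moving the quadratic term to the real side reduces every estimate of
    \<open>F\<close> to one of \<open>f\<close>.\<close>
  have F: "F y \<le> ereal c \<longleftrightarrow> f y \<le> ereal (c - k * (dist x y)\<^sup>2)" for y c
    unfolding F_def by (cases "f y") auto
  have "\<exists>p. Argmin F = {p}"
  proof (rule strongly_convex_Argmin)
    show "ereal m \<le> F y" for y
      using lower[of y] \<open>k > 0\<close> unfolding F_def by (cases "f y") (auto intro: add_increasing2)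
    show "F a < \<infinity>" using proper by (simp add: F_def)
    show "(k - \<alpha>) / 4 > 0" using \<open>k > \<alpha>\<close> by simp
    show "F q \<le> ereal c'" if "z \<longlonglongrightarrow> q" "c \<longlonglongrightarrow> c'" "\<And>n. F (z n) \<le> ereal (c n)" for z q c c'
    proof -
      have "(\<lambda>n. c n - k * (dist x (z n))\<^sup>2) \<longlonglongrightarrow> c' - k * (dist x q)\<^sup>2"
        using that by (intro tendsto_intros)
      then show ?thesis
        unfolding F by (rule lower_semicontinuous_limit_le[OF lsc \<open>z \<longlonglongrightarrow> q\<close>]) (use that F in blast)
    qed
    show "F (geodesic_point y z (1/2)) \<le> ereal ((b + c) / 2 - (k - \<alpha>) / 4 * (dist y z)\<^sup>2)"
      if "F y \<le> ereal b" "F z \<le> ereal c" for y z b c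
    proof -
      let ?m = "geodesic_point y z (1/2)"
      have "f ?m \<le> ereal ((b - k * (dist x y)\<^sup>2 + (c - k * (dist x z)\<^sup>2)) / 2 + \<alpha> / 4 * (dist y z)\<^sup>2)"
        by (intro weakly_convex_midpoint wc) (use that F in auto)
      also have "\<dots> \<le> ereal ((b + c) / 2 - (k - \<alpha>) / 4 * (dist y z)\<^sup>2 - k * (dist x ?m)\<^sup>2)"
        using mult_left_mono[OF CN_inequality_midpoint[of x y z], of k] \<open>k > 0\<close>
        by (simp add: field_simps)
      finally show ?thesis unfolding F .
    qed
  qed
  then obtain p where p: "Argmin F = {p}" by blast
  then have "resolvent f l x = p"
    unfolding resolvent_def k_def[symmetric] F_def[symmetric] by simp
  moreover have "F p \<le> F y" using p unfolding Argmin_def by blast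
  ultimately show ?thesis by (simp add: F_def k_def)
qed

text \<open>By quasi-convexity \<open>f\<close> does not exceed \<open>f q\<close> on the geodesic
  from \<open>q\<close> to \<open>y\<close>. A point there that is closer to \<open>x\<close> would
  have a smaller objective, so \<open>q\<close> is nearest to \<open>x\<close> on this
  geodesic.\<close>

lemma proximal_point_pythagoras:
  fixes f :: "'a::cat0_space \<Rightarrow> ereal"
  assumes min: "\<And>z. f q + ereal (k * (dist x q)\<^sup>2) \<le> f z + ereal (k * (dist x z)\<^sup>2)"
    and "k > 0" "quasi_convex f" "f q = ereal c" "f y \<le> f q"
  shows "(dist x q)\<^sup>2 + (dist q y)\<^sup>2 \<le> (dist x y)\<^sup>2"
proof (rule pythagoras_of_nearest_on_geodesic)
  fix t :: real assume "0 < t" "t < 1"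
  then have "f (geodesic_point q y t) \<le> ereal c"
    using quasi_convex_geodesic_le[OF assms(3), of t q y] assms(4,5) by (simp add: max_absorb1)
  have "ereal c + ereal (k * (dist x q)\<^sup>2)
      \<le> f (geodesic_point q y t) + ereal (k * (dist x (geodesic_point q y t))\<^sup>2)"
    using min[of "geodesic_point q y t"] assms(4) by simp
  also have "\<dots> \<le> ereal c + ereal (k * (dist x (geodesic_point q y t))\<^sup>2)"
    by (intro add_right_mono) fact
  finally have "k * (dist x q)\<^sup>2 \<le> k * (dist x (geodesic_point q y t))\<^sup>2" by simp
  then have "(dist x q)\<^sup>2 \<le> (dist x (geodesic_point q y t))\<^sup>2" using \<open>k > 0\<close> by simp
  then show "dist x q \<le> dist x (geodesic_point q y t)" by (simp add: power2_le_iff_abs_le)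
qed

section \<open>Quadratic lower bounds near the limit point\<close>

text \<open>Weak convexity is applied only to the initial piece of length \<open>2 * s\<close> of
  the geodesic from \<open>y\<close> to \<open>x (Suc n)\<close>. Its error at the midpoint is then
  \<open>\<alpha> * s\<^sup>2\<close>, however far away \<open>x (Suc n)\<close> is.\<close>

lemma weakly_convex_lower_bound_near_asymptotic_center:
  fixes f :: "'a::hadamard_space \<Rightarrow> ereal"
  assumes bdd: "bounded (range x)" and p: "p \<in> asymptotic_center x"
    and s: "dist y p < s" "2 * s < real_asymptotic_radius p x"
    and wc: "weakly_convex \<alpha> f" and "\<alpha> \<ge> 0" and qc: "quasi_convex f"
    and g: "\<And>n. f (x (Suc n)) = ereal (g n)" "\<And>n. c \<le> g n" "g \<longlonglongrightarrow> c"
    and fejer: "\<And>y n. f y \<le> ereal c \<Longrightarrow> dist y (x (Suc n)) \<le> dist y (x n)"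
    and y: "f y = ereal b"
  shows "c - 2 * \<alpha> * s\<^sup>2 \<le> b"
proof (cases "b \<le> c")
  case False
  moreover have "0 \<le> 2 * \<alpha> * s\<^sup>2" using \<open>\<alpha> \<ge> 0\<close> by simp
  ultimately show ?thesis by linarith
next
  case True
  define R where "R = real_asymptotic_radius p x"
  \<comment> \<open>Distances from such a \<open>z\<close> to the sequence decrease, so each of them
    is at least the radius at \<open>z\<close>, which is at least the minimal radius
    \<open>R\<close>.\<close>
  have R_le: "R \<le> dist z (x n)" if "f z \<le> ereal c" for z n
  proof -
    have "dist z (x m) \<le> dist z (x n)" if "m \<ge> n" for m
      using lift_Suc_antimono_le[of "\<lambda>n. dist z (x n)"] fejer[OF \<open>f z \<le> ereal c\<close>] that by blast
    then have "real_asymptotic_radius z x \<le> dist z (x n)"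
      by (intro real_asymptotic_radius_le[OF bdd]) (auto simp: eventually_sequentially)
    moreover have "R \<le> real_asymptotic_radius z x"
      using p unfolding R_def asymptotic_center_iff[OF bdd] by blast
    ultimately show ?thesis by simp
  qed
  have "s > 0" using s(1) by (meson le_less_trans zero_le_dist)
  \<comment> \<open>The margin \<open>s - dist y p\<close> is what the triangle inequality through
    \<open>p\<close> needs to give \<open>L < R + s\<close>.\<close>
  have "\<forall>\<^sub>F n in sequentially. dist p (x n) < R + (s - dist y p)"
    using s(1) unfolding R_def by (intro eventually_dist_less_of_radius_less[OF bdd]) simp
  then have "\<forall>\<^sub>F n in sequentially. dist p (x (Suc n)) < R + (s - dist y p)"
    by (rule eventually_sequentially_Suc[THEN iffD2])
  then have "\<forall>\<^sub>F n in sequentially. c \<le> (b + g n) / 2 + \<alpha> * s\<^sup>2"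
  proof (rule eventually_mono)
    fix n assume near: "dist p (x (Suc n)) < R + (s - dist y p)"
    define L where "L = dist y (x (Suc n))"
    have "L < R + s" using near dist_triangle[of y "x (Suc n)" p] by (simp add: L_def)
    \<comment> \<open>Since \<open>b \<le> c\<close>, the bound \<open>R_le\<close> applies to
      \<open>y\<close> itself; thus the geodesic is long enough to contain
      \<open>z1\<close>.\<close>
    have "2 * s < L" using R_le[of y "Suc n"] y True s(2) by (simp add: L_def R_def)
    define z1 where "z1 = geodesic_point y (x (Suc n)) (2 * s / L)"
    have t: "0 \<le> 2 * s / L" "2 * s / L \<le> 1" using \<open>2 * s < L\<close> \<open>s > 0\<close> by auto
    have "dist y z1 = 2 * s / L * L" "dist (x (Suc n)) z1 = (1 - 2 * s / L) * L"
      unfolding z1_def L_def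
      by (rule dist_geodesic_point_left[OF t[unfolded L_def]] dist_geodesic_point_right[OF t[unfolded L_def]])+
    then have z1: "dist y z1 = 2 * s" "dist (x (Suc n)) z1 = L - 2 * s"
      using \<open>2 * s < L\<close> \<open>s > 0\<close> by (simp_all add: left_diff_distrib)
    have "f z1 \<le> max (f y) (f (x (Suc n)))"
      unfolding z1_def by (rule quasi_convex_geodesic_le[OF qc t])
    also have "\<dots> = ereal (g n)" using y g True by (simp add: max_def order_trans)
    finally have "f z1 \<le> ereal (g n)" .
    define z0 where "z0 = geodesic_point y z1 (1/2)"
    have "dist z1 z0 = s" using dist_geodesic_point_right[of "1/2" z1 y] z1 by (simp add: z0_def)
    \<comment> \<open>Through \<open>z1\<close> the distance is at most
      \<open>s + (L - 2 * s) = L - s\<close>. By \<open>R_le\<close> this rules out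
      \<open>f z0 \<le> ereal c\<close>.\<close>
    then have "dist z0 (x (Suc n)) < R"
      using dist_triangle[of z0 "x (Suc n)" z1] z1 \<open>L < R + s\<close> by (simp add: dist_commute)
    then have "ereal c < f z0" using R_le[of z0 "Suc n"] by fastforce
    also have "f z0 \<le> ereal ((b + g n) / 2 + \<alpha> / 4 * (dist y z1)\<^sup>2)"
      unfolding z0_def using y \<open>f z1 \<le> ereal (g n)\<close> by (intro weakly_convex_midpoint[OF wc]) auto
    finally show "c \<le> (b + g n) / 2 + \<alpha> * s\<^sup>2" by (simp add: z1 power_mult_distrib)
  qed
  moreover have "(\<lambda>n. (b + g n) / 2 + \<alpha> * s\<^sup>2) \<longlonglongrightarrow> (b + c) / 2 + \<alpha> * s\<^sup>2"
    using g(3) by (intro tendsto_intros) auto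
  ultimately have "c \<le> (b + c) / 2 + \<alpha> * s\<^sup>2"
    by (intro tendsto_lowerbound[OF _ _ sequentially_bot])
  then show ?thesis by argo
qed

text \<open>The difference quotient is at most \<open>K * dist p y\<close>, which tends to
  0.\<close>

lemma slope_eq_0_of_quadratic_lower_bound:
  assumes "f p = ereal c" "K \<ge> 0" "\<delta> > 0"
    and lower: "\<And>y. dist p y < \<delta> \<Longrightarrow> ereal (c - K * (dist p y)\<^sup>2) \<le> f y"
  shows "slope f p = 0"
proof -
  have "Limsup (at p) (\<lambda>y. max (f p - f y) 0 / ereal (dist p y)) \<le> 0"
  proof (rule ereal_le_epsilon2)
    fix e :: real assume "e > 0"
    have "\<forall>\<^sub>F y in at p. max (f p - f y) 0 / ereal (dist p y) \<le> ereal e"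
      unfolding eventually_at
    proof (intro exI conjI ballI impI)
      \<comment> \<open>The denominator \<open>K + 1\<close> covers the case
        \<open>K = 0\<close>.\<close>
      show "min \<delta> (e / (K + 1)) > 0" using assms(2,3) \<open>e > 0\<close> by simp
      fix y assume "y \<noteq> p \<and> dist y p < min \<delta> (e / (K + 1))"
      then have y: "dist p y > 0" "dist p y < \<delta>" "(K + 1) * dist p y < e"
        using \<open>K \<ge> 0\<close> by (auto simp: dist_commute field_simps)
      have "K * dist p y \<le> e" using y unfolding distrib_right by linarith
      show "max (f p - f y) 0 / ereal (dist p y) \<le> ereal e"
      proof (cases "f y")
        case (real b)
        then have "c - b \<le> K * dist p y * dist p y"
          using lower[OF y(2)] by (simp add: power2_eq_square algebra_simps)
        also have "\<dots> \<le> e * dist p y"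
          using \<open>K * dist p y \<le> e\<close> by (rule mult_right_mono) simp
        finally have "max (c - b) 0 / dist p y \<le> e" using y(1) \<open>e > 0\<close> by (simp add: divide_le_eq)
        then show ?thesis using real assms(1) y(1) by (auto simp: max_def zero_ereal_def split: if_splits)
      next
        case PInf
        then show ?thesis using assms(1) \<open>e > 0\<close> by (simp add: max_def)
      next
        case MInf
        then show ?thesis using lower[OF y(2)] by simp
      qed
    qed
    then show "Limsup (at p) (\<lambda>y. max (f p - f y) 0 / ereal (dist p y)) \<le> 0 + ereal e"
      by (simp add: Limsup_bounded)
  qed
  then show ?thesis by (simp add: slope_def max_absorb1)
qed

text \<open>Towards a point of smaller value, pseudo-convexity makes \<open>f\<close> drop at least
  linearly in \<open>t\<close>, while the lower bound allows only a quadratic drop; small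
  \<open>t\<close> gives a contradiction.\<close>

lemma Argmin_of_quadratic_lower_bound:
  fixes f :: "'a::cat0_space \<Rightarrow> ereal"
  assumes "f p = ereal c" "K \<ge> 0" "\<delta> > 0"
    and lower: "\<And>y. dist p y < \<delta> \<Longrightarrow> ereal (c - K * (dist p y)\<^sup>2) \<le> f y"
    and "pseudo_convex f"
  shows "p \<in> Argmin f"
proof (rule ccontr)
  assume "p \<notin> Argmin f"
  then obtain y where "f y < f p" unfolding Argmin_def by (auto simp: not_le)
  then obtain \<beta> d where "\<beta> > 0" "0 < d" "d \<le> 1"
    and \<beta>: "\<And>t. 0 < t \<Longrightarrow> t < d \<Longrightarrow> f p - f (geodesic_point y p (1 - t)) \<ge> ereal (t * \<beta>)"
    using assms(5) unfolding pseudo_convex_def by (metis greaterThanLessThan_iff)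
  define D where "D = dist p y"
  have "D > 0" using \<open>f y < f p\<close> unfolding D_def by auto
  \<comment> \<open>The three bounds keep \<open>t\<close> in the range of pseudo-convexity, keep
    the point within \<delta> of \<open>p\<close>, and make the quadratic drop smaller than
    \<open>t * \<beta>\<close>.\<close>
  define t where "t = min (d / 2) (min (\<delta> / (2 * D)) (\<beta> / (2 * (K + 1) * D\<^sup>2)))"
  have t: "0 < t" "t < d" using \<open>\<beta> > 0\<close> \<open>0 < d\<close> \<open>D > 0\<close> assms(2,3) by (auto simp: t_def)
  have "t \<le> \<delta> / (2 * D)" "t \<le> \<beta> / (2 * (K + 1) * D\<^sup>2)" unfolding t_def by auto
  moreover have "0 < 2 * (K + 1) * D\<^sup>2" using \<open>D > 0\<close> assms(2) by simp
  ultimately have "t * (2 * D) \<le> \<delta>" "t * (2 * (K + 1) * D\<^sup>2) \<le> \<beta>"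
    using \<open>D > 0\<close> by (simp_all add: pos_le_divide_eq)
  then have "t * D < \<delta>" and "2 * (K + 1) * D\<^sup>2 * t \<le> \<beta>"
    using assms(3) by (simp_all add: mult_ac)
  define z where "z = geodesic_point y p (1 - t)"
  have z: "dist p z = t * D"
    using dist_geodesic_point_right[of "1 - t" p y] t \<open>d \<le> 1\<close> by (simp add: z_def D_def dist_commute)
  have "ereal (c - K * (t * D)\<^sup>2) \<le> f z" using lower[of z] z \<open>t * D < \<delta>\<close> by simp
  moreover have "ereal (t * \<beta>) \<le> ereal c - f z" using \<beta>[OF t] assms(1) by (simp add: z_def)
  ultimately have "t * \<beta> \<le> K * (t * D)\<^sup>2" by (cases "f z") auto
  then have "t * \<beta> \<le> t * (K * D\<^sup>2 * t)" by (simp add: power2_eq_square algebra_simps)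
  then have "\<beta> \<le> K * D\<^sup>2 * t" using t by simp
  moreover have "0 < D\<^sup>2 * t" "0 \<le> K * D\<^sup>2 * t" using \<open>D > 0\<close> t assms(2) by auto
  ultimately show False using \<open>2 * (K + 1) * D\<^sup>2 * t \<le> \<beta>\<close> by (simp add: algebra_simps)
qed

section \<open>Convergence of the proximal sequence and criticality of its limit\<close>

theorem theorem3p4:
  fixes f :: "'a::hadamard_space \<Rightarrow> ereal"
    and \<alpha> lbar :: real
    and l :: "nat \<Rightarrow> real"
    and x :: "nat \<Rightarrow> 'a"
  assumes "\<alpha> > 0"
    and "\<forall>y. f y \<noteq> -\<infinity>"
    and "proper_function f"
    and "lower_semicontinuous f"
    and "weakly_convex \<alpha> f"
    and "quasi_convex f"
    and "\<forall>y\<in>effective_domain f. isCont f y"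
    and "Argmin f \<noteq> {}"
    and "lbar > 0"
    and "\<forall>n. lbar \<le> l n \<and> l n < 1 / (2 * \<alpha>)"
    and "\<forall>n. x (Suc n) = resolvent f (l n) (x n)"
  shows "\<exists>p. delta_converges x p \<and> critical_point f p \<and> (pseudo_convex f \<longrightarrow> p \<in> Argmin f)"
proof -
  note \<alpha> = assms(1) and proper = assms(3) and lsc = assms(4) and wc = assms(5) and qc = assms(6)
  have l: "0 < l n" "l n < 1 / (2 * \<alpha>)" for n
    using assms(9,10) less_le_trans by blast+
  obtain a where a: "\<And>y. f a \<le> f y" using assms(8) unfolding Argmin_def by blast
  then have "f a < \<infinity>"
    using proper le_less_trans unfolding proper_function_def effective_domain_def by blast
  then obtain m where m: "f a = ereal m" using assms(2) by (cases "f a") auto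
  define k where "k n = 1 / (2 * l n)" for n
  have k: "k n > 0" for n using l by (simp add: k_def)
  have step: "f (x (Suc n)) + ereal (k n * (dist (x n) (x (Suc n)))\<^sup>2)
      \<le> f y + ereal (k n * (dist (x n) y)\<^sup>2)" for n y
    unfolding k_def assms(11)[rule_format]
    by (rule resolvent_minimizes[where m = m, OF _ \<open>f a < \<infinity>\<close> lsc wc l \<alpha>]) (use a m in simp)
  have "f (x (Suc n)) < \<infinity>" for n
    using step[of n a] m by (cases "f (x (Suc n))") auto
  then have "\<exists>r. f (x (Suc n)) = ereal r" for n
    using assms(2) by (cases "f (x (Suc n))") (auto simp: less_top)
  \<comment> \<open>The starting point may lie outside the effective domain, so values are recorded
    from \<open>x 1\<close> on and \<open>g\<close> is shifted by one.\<close>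
  then obtain g where g: "\<And>n. f (x (Suc n)) = ereal (g n)" by metis
  have "g (Suc n) \<le> g n" for n
  proof -
    have "g (Suc n) + k (Suc n) * (dist (x (Suc n)) (x (Suc (Suc n))))\<^sup>2 \<le> g n"
      using step[of "Suc n" "x (Suc n)"] by (simp add: g)
    moreover have "0 \<le> k (Suc n) * (dist (x (Suc n)) (x (Suc (Suc n))))\<^sup>2"
      using k[of "Suc n"] by simp
    ultimately show ?thesis by linarith
  qed
  then have dec: "decseq g" by (rule decseq_SucI)
  have "m \<le> g n" for n using a[of "x (Suc n)"] by (simp add: m g)
  then obtain c where c: "g \<longlonglongrightarrow> c" "\<And>n. c \<le> g n"
    using decseq_convergent[OF dec] by blast
  have fejer: "dist y (x (Suc n)) \<le> dist y (x n)" if "f y \<le> ereal c" for y n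
  proof -
    have "f y \<le> f (x (Suc n))" using that c(2)[of n] g by (simp add: order_trans)
    from proximal_point_pythagoras[OF step k qc g this]
    have "(dist (x (Suc n)) y)\<^sup>2 \<le> (dist (x n) y)\<^sup>2"
      using zero_le_power2[of "dist (x n) (x (Suc n))"] by linarith
    then show ?thesis by (simp add: power2_le_iff_abs_le dist_commute)
  qed
  \<comment> \<open>Hence the minimum point \<open>a\<close> lies in the sublevel set at
    \<open>c\<close>, and Fejer monotonicity with respect to \<open>a\<close> bounds the
    sequence.\<close>
  have "m \<le> c" using c(1) \<open>\<And>n. m \<le> g n\<close> by (simp add: LIMSEQ_le_const)
  then have "dist a (x n) \<le> dist a (x 0)" for n
    by (induction n) (use fejer[of a] m order_trans in auto)
  then have bdd: "bounded (range x)" unfolding bounded_any_center[of _ a] by auto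
  have center: "asymptotic_center (x \<circ> j) \<subseteq> {y. f y \<le> ereal c}" if j: "strict_mono j" for j
  proof
    fix p assume p: "p \<in> asymptotic_center (x \<circ> j)"
    \<comment> \<open>A tail of the subsequence lies in the closed convex sublevel set at
      \<open>g n\<close>, hence so does \<open>p\<close>; then \<open>n\<close> tends to
      infinity.\<close>
    have "f p \<le> ereal (g n)" for n
    proof -
      have "p \<in> {y. f y \<le> ereal (g n)}"
      proof (rule asymptotic_center_in_closed_convex[OF _ closed_sublevel[OF lsc] _ _ p])
        show "bounded (range (x \<circ> j))" by (rule bounded_subset[OF bdd]) auto
        show "\<forall>\<^sub>F i in sequentially. (x \<circ> j) i \<in> {y. f y \<le> ereal (g n)}"
          unfolding eventually_sequentially
        proof (intro exI allI impI)
          fix i assume "Suc n \<le> i"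
          then have "Suc n \<le> j i" using seq_suble[OF j, of i] by linarith
          then obtain i' where "j i = Suc i'" "n \<le> i'" by (metis Suc_le_D Suc_le_mono)
          then show "(x \<circ> j) i \<in> {y. f y \<le> ereal (g n)}"
            using decseqD[OF dec] by (simp add: g)
        qed
        show "geodesic_point y z t \<in> {y. f y \<le> ereal (g n)}"
          if "y \<in> {y. f y \<le> ereal (g n)}" "z \<in> {y. f y \<le> ereal (g n)}" "0 \<le> t" "t \<le> 1" for y z t
          using that quasi_convex_geodesic_le[OF qc, of t y z]
          by (auto intro: order_trans simp: max_def split: if_splits)
      qed
      then show ?thesis by simp
    qed
    moreover have "(\<lambda>n. ereal (g n)) \<longlonglongrightarrow> ereal c" using c(1) by simp
    ultimately show "p \<in> {y. f y \<le> ereal c}" by (auto intro: LIMSEQ_le_const)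
  qed
  obtain p where p: "f p \<le> ereal c" "p \<in> asymptotic_center x" "delta_converges x p"
    using fejer_monotone_delta_converges[OF bdd _ center] fejer by auto
  obtain K \<delta> where K: "K \<ge> 0" "\<delta> > 0"
    and lower: "\<And>y. dist p y < \<delta> \<Longrightarrow> ereal (c - K * (dist p y)\<^sup>2) \<le> f y"
  proof (cases "real_asymptotic_radius p x = 0")
    case True
    have "x \<longlonglongrightarrow> p"
    proof (rule metric_LIMSEQ_I)
      fix e :: real assume "e > 0"
      then show "\<exists>N. \<forall>n\<ge>N. dist (x n) p < e"
        using eventually_dist_less_of_radius_less[OF bdd, of p e] True
        by (simp add: eventually_sequentially dist_commute)
    qed
    have "ereal (c - 1 / (2 * lbar) * (dist p y)\<^sup>2) \<le> f y" for y
    proof (cases "f y")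
      case (real b)
      \<comment> \<open>Here the steps being bounded away from 0 enters: \<open>k n\<close> is at
        most \<open>1 / (2 * lbar)\<close> uniformly in \<open>n\<close>, so the resolvent
        inequality survives the limit.\<close>
      have "g n \<le> b + 1 / (2 * lbar) * (dist (x n) y)\<^sup>2" for n
      proof -
        have "g n + k n * (dist (x n) (x (Suc n)))\<^sup>2 \<le> b + k n * (dist (x n) y)\<^sup>2"
          using step[of n y] by (simp add: g real)
        moreover have "0 \<le> k n * (dist (x n) (x (Suc n)))\<^sup>2" using k[of n] by simp
        moreover have "k n \<le> 1 / (2 * lbar)"
          using assms(9,10) l by (simp add: k_def frac_le)
        then have "k n * (dist (x n) y)\<^sup>2 \<le> 1 / (2 * lbar) * (dist (x n) y)\<^sup>2"
          by (rule mult_right_mono) simp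
        ultimately show ?thesis by linarith
      qed
      moreover have "(\<lambda>n. b + 1 / (2 * lbar) * (dist (x n) y)\<^sup>2) \<longlonglongrightarrow> b + 1 / (2 * lbar) * (dist p y)\<^sup>2"
        using \<open>x \<longlonglongrightarrow> p\<close> by (intro tendsto_intros)
      ultimately have "c \<le> b + 1 / (2 * lbar) * (dist p y)\<^sup>2"
        using LIMSEQ_le[OF c(1)] by blast
      then show ?thesis by (simp add: real)
    qed (use assms(2) in auto)
    then show ?thesis using assms(9) by (intro that[of "1 / (2 * lbar)" 1]) auto
  next
    case False
    define R where "R = real_asymptotic_radius p x"
    have "R > 0" using False real_asymptotic_radius_nonneg[OF bdd, of p] by (simp add: R_def)
    have "ereal (c - 2 * \<alpha> * (dist p y)\<^sup>2) \<le> f y" if "dist p y < R / 2" for y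
    proof (cases "f y")
      case (real b)
      \<comment> \<open>The radius \<open>s\<close> must exceed \<open>dist p y\<close> strictly, so
        the bound is proved for all such \<open>s\<close> and then \<open>s\<close> decreases to
        \<open>dist p y\<close>.\<close>
      have "c - 2 * \<alpha> * s\<^sup>2 \<le> b" if "dist p y < s" "s < R / 2" for s
        using weakly_convex_lower_bound_near_asymptotic_center[OF bdd p(2) _ _ wc _ qc g c(2,1) fejer real, of s]
          that \<alpha> by (simp add: R_def dist_commute)
      then have "\<forall>\<^sub>F s in at_right (dist p y). c - 2 * \<alpha> * s\<^sup>2 \<le> b"
        using that by (intro eventually_at_rightI[of _ "R / 2"]) auto
      moreover have "((\<lambda>s. c - 2 * \<alpha> * s\<^sup>2) \<longlongrightarrow> c - 2 * \<alpha> * (dist p y)\<^sup>2) (at_right (dist p y))"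
        by (intro tendsto_intros)
      ultimately have "c - 2 * \<alpha> * (dist p y)\<^sup>2 \<le> b"
        using tendsto_upperbound[OF _ _ trivial_limit_at_right_real] by blast
      then show ?thesis by (simp add: real)
    qed (use assms(2) in auto)
    then show ?thesis using \<alpha> \<open>R > 0\<close> by (intro that[of "2 * \<alpha>" "R / 2"]) auto
  qed
  \<comment> \<open>At \<open>y = p\<close> the quadratic term vanishes, so \<open>lower\<close>
    gives the inequality opposite to \<open>p(1)\<close>.\<close>
  have fp: "f p = ereal c" using p(1) lower[of p] \<open>\<delta> > 0\<close> by (simp add: antisym)
  then have "critical_point f p"
    using slope_eq_0_of_quadratic_lower_bound[OF fp K lower]
    by (simp add: critical_point_def effective_domain_def)
  moreover have "pseudo_convex f \<longrightarrow> p \<in> Argmin f"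
    using Argmin_of_quadratic_lower_bound[OF fp K lower] by blast
  ultimately show ?thesis using p(3) by blast
qed

end
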